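(* Let $R=(r_0,\dots,r_n)\in\mathbb N^{n+1}$, let $\mathcal R=\mathrm{diag}(r_0,\dots,r_n)$, and let $\Lambda$ be a uniform sub-lattice of $\Lambda_R$ of rank $n$. Then $\Lambda$ has the Riemann-Roch property if and only if the lattice $\mathcal R\Lambda=\{\mathcal Rp:p\in\Lambda\}\subseteq\Lambda_{\vec 1}$ has the Riemann-Roch property.
   Context: $\mathbb N$ denotes the positive integers; inequalities between vectors are coordinatewise; $\vec 0,\vec 1\in\mathbb R^{n+1}$ are the all-zeros and all-ones vectors. For $R\in\mathbb N^{n+1}$ (including $R=\vec 1$) put $\Lambda_R=\{D\in\mathbb Z^{n+1}:D\cdot R=0\}$ and $\deg_R(x)=x\cdot R$. For a sub-lattice $\Lambda\subseteq\Lambda_R$ of rank $n$ the following notions are defined with respect to $\Lambda$ and $\deg_R$ (for $\mathcal R\Lambda\subseteq\Lambda_{\vec 1}$ they are taken with respect to $\deg_{\vec 1}$). Rank: $D\sim D'$ means $D-D'\in\Lambda$; $|D|=\{E\in\mathbb Z^{n+1}:E\ge\vec 0,\ E\sim D\}$; $r(D)=\min\{\deg_R(E):E\in\mathbb Z^{n+1},\ E\ge\vec 0,\ |D-E|=\emptyset\}-1$. Uniformity: $\Sigma(\Lambda)=\{D\in\mathbb Z^{n+1}:D\not\ge p\text{ for all }p\in\Lambda\}$; $Ext(\Sigma(\Lambda))$ is the set of $\nu\in\Sigma(\Lambda)$ with $\deg_R(\nu)\ge\deg_R(p)$ for all $p\in\Sigma(\Lambda)$ satisfying $\sum_i|p_i-\nu_i|\le1$;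 $g_{\min}$ (resp. $g_{\max}$) is the minimum (resp. maximum) of $\deg_R(\nu)$ over $\nu\in Ext(\Sigma(\Lambda))$, plus $1$; $\Lambda$ is uniform if $g_{\min}=g_{\max}$. Riemann-Roch property: $\Lambda$ has the Riemann-Roch property if it is uniform and, with $g=g_{\min}=g_{\max}$, there exists $K\in\mathbb Z^{n+1}$ with $\deg_R(K)=2g-2$ such that $r(D)-r(K-D)=\deg_R(D)-g+1$ for all $D\in\mathbb Z^{n+1}$. *)

theory Defs
  imports "HOL-Analysis.Analysis"
begin

text \<open>
  Vectors of length $n+1$ are indexed by a finite type \<open>'n\<close> with \<open>CARD('n) = n + 1\<close>. The order on
  \<open>int ^ 'n\<close> is the coordinatewise one, and \<open>0\<close> and \<open>1\<close> are the all-zeros and all-ones vectors.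
\<close>

definition degR :: "nat ^ 'n \<Rightarrow> int ^ 'n \<Rightarrow> int" where
  "degR R x = (\<Sum>i\<in>UNIV. x $ i * int (R $ i))"

definition LambdaR :: "nat ^ 'n \<Rightarrow> (int ^ 'n) set" where
  "LambdaR R = {D. degR R D = 0}"

definition is_lattice :: "(int ^ 'n) set \<Rightarrow> bool" where
  "is_lattice \<Lambda> \<longleftrightarrow> 0 \<in> \<Lambda> \<and> (\<forall>p\<in>\<Lambda>. \<forall>q\<in>\<Lambda>. p - q \<in> \<Lambda>)"

definition real_vec :: "int ^ 'n \<Rightarrow> real ^ 'n" where
  "real_vec x = (\<chi> i. real_of_int (x $ i))"

text \<open>The rank of a lattice is the dimension of its real span (\<open>dim\<close> of a set is that of its span).\<close>

definition lattice_rank :: "(int ^ 'n) set \<Rightarrow> nat" where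
  "lattice_rank \<Lambda> = dim (real_vec ` \<Lambda>)"

definition full_sublattice :: "nat ^ 'n \<Rightarrow> (int ^ 'n) set \<Rightarrow> bool" where
  "full_sublattice R \<Lambda> \<longleftrightarrow>
     is_lattice \<Lambda> \<and> \<Lambda> \<subseteq> LambdaR R \<and> lattice_rank \<Lambda> = CARD('n) - 1"

definition lin_equiv :: "(int ^ 'n) set \<Rightarrow> int ^ 'n \<Rightarrow> int ^ 'n \<Rightarrow> bool" where
  "lin_equiv \<Lambda> D D' \<longleftrightarrow> D - D' \<in> \<Lambda>"

definition linear_system :: "(int ^ 'n) set \<Rightarrow> int ^ 'n \<Rightarrow> (int ^ 'n) set" where
  "linear_system \<Lambda> D = {E. E \<ge> 0 \<and> lin_equiv \<Lambda> E D}"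

text \<open>
  Minima and maxima of sets of integers are written with \<open>LEAST\<close> and \<open>GREATEST\<close>. For a full
  sub-lattice of \<open>LambdaR R\<close> with \<open>R\<close> positive they are all attained; otherwise the values below
  may be unspecified.
\<close>

definition divisor_rank :: "nat ^ 'n \<Rightarrow> (int ^ 'n) set \<Rightarrow> int ^ 'n \<Rightarrow> int" where
  "divisor_rank R \<Lambda> D =
     (LEAST d. d \<in> {degR R E | E. E \<ge> 0 \<and> linear_system \<Lambda> (D - E) = {}}) - 1"

definition Sigma_region :: "(int ^ 'n) set \<Rightarrow> (int ^ 'n) set" where
  "Sigma_region \<Lambda> = {D. \<forall>p\<in>\<Lambda>. \<not> D \<ge> p}"

definition Ext_Sigma :: "nat ^ 'n \<Rightarrow> (int ^ 'n) set \<Rightarrow> (int ^ 'n) set" where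
  "Ext_Sigma R \<Lambda> = {\<nu> \<in> Sigma_region \<Lambda>.
     \<forall>p\<in>Sigma_region \<Lambda>. (\<Sum>i\<in>UNIV. \<bar>p $ i - \<nu> $ i\<bar>) \<le> 1 \<longrightarrow> degR R \<nu> \<ge> degR R p}"

definition g_min :: "nat ^ 'n \<Rightarrow> (int ^ 'n) set \<Rightarrow> int" where
  "g_min R \<Lambda> = (LEAST d. d \<in> degR R ` Ext_Sigma R \<Lambda>) + 1"

definition g_max :: "nat ^ 'n \<Rightarrow> (int ^ 'n) set \<Rightarrow> int" where
  "g_max R \<Lambda> = (GREATEST d. d \<in> degR R ` Ext_Sigma R \<Lambda>) + 1"

definition uniform_lattice :: "nat ^ 'n \<Rightarrow> (int ^ 'n) set \<Rightarrow> bool" where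
  "uniform_lattice R \<Lambda> \<longleftrightarrow> g_min R \<Lambda> = g_max R \<Lambda>"

definition riemann_roch_property :: "nat ^ 'n \<Rightarrow> (int ^ 'n) set \<Rightarrow> bool" where
  "riemann_roch_property R \<Lambda> \<longleftrightarrow>
     uniform_lattice R \<Lambda> \<and>
     (let g = g_min R \<Lambda> in
        \<exists>K. degR R K = 2 * g - 2 \<and>
          (\<forall>D. divisor_rank R \<Lambda> D - divisor_rank R \<Lambda> (K - D) = degR R D - g + 1))"

definition diag_matrix :: "nat ^ 'n \<Rightarrow> int ^ 'n ^ 'n" where
  "diag_matrix R = (\<chi> i j. if i = j then int (R $ i) else 0)"

definition scaled_lattice :: "nat ^ 'n \<Rightarrow> (int ^ 'n) set \<Rightarrow> (int ^ 'n) set" where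
  "scaled_lattice R \<Lambda> = (\<lambda>p. diag_matrix R *v p) ` \<Lambda>"

lemma diag_matrix_mult_nth: "(diag_matrix R *v p) $ i = int (R $ i) * p $ i"
  by (simp add: diag_matrix_def matrix_vector_mult_def if_distrib[where f = "\<lambda>x. x * _"] cong: if_cong)

lemma full_sublattice_scaled_lattice:
  fixes R :: "nat ^ 'n" and \<Lambda> :: "(int ^ 'n) set"
  assumes pos: "\<forall>i. R $ i > 0" and L: "full_sublattice R \<Lambda>"
  shows "full_sublattice 1 (scaled_lattice R \<Lambda>)"
proof -
  let ?f = "\<lambda>x::real ^ 'n. \<chi> i. real (R $ i) * x $ i"
  have lin: "linear ?f"
    by (rule linearI) (simp_all add: vec_eq_iff algebra_simps)
  have inj: "inj ?f"
    using pos by (intro injI) (simp add: vec_eq_iff, metis less_irrefl)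
  have img: "real_vec ` scaled_lattice R \<Lambda> = ?f ` (real_vec ` \<Lambda>)"
    unfolding scaled_lattice_def image_image
    by (intro image_cong refl) (simp add: vec_eq_iff real_vec_def diag_matrix_mult_nth)
  have "dim (real_vec ` scaled_lattice R \<Lambda>) = dim (real_vec ` \<Lambda>)"
    unfolding img using lin inj by (rule dim_image_eq[OF _ inj_on_subset]) simp
  moreover have "is_lattice (scaled_lattice R \<Lambda>)"
    using L unfolding full_sublattice_def is_lattice_def scaled_lattice_def
    by (auto simp flip: matrix_vector_mult_diff_distrib intro: image_eqI[of _ _ 0])
  moreover have "scaled_lattice R \<Lambda> \<subseteq> LambdaR 1"
    using L unfolding full_sublattice_def LambdaR_def scaled_lattice_def degR_def
    by (auto simp: diag_matrix_mult_nth mult.commute)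
  ultimately show ?thesis
    using L by (simp add: full_sublattice_def lattice_rank_def)
qed

end

theory Submission
  imports Defs
begin

text \<open>
  The set \<open>Ext_Sigma\<close> consists of the maximal elements of the down-set \<open>Sigma_region\<close>, and an
  effective divisor \<open>E\<close> competes in the rank of \<open>D\<close> iff \<open>D - E\<close> lies below some \<open>\<nu> \<in> Ext_Sigma\<close>.
  Exchanging \<open>E\<close> and \<open>\<nu> - (D - E)\<close> shows that a full sub-lattice has the Riemann-Roch property iff
  all its extreme points have the same degree and they are permuted by some reflection
  \<open>\<nu> \<mapsto> K - \<nu>\<close>. Since \<open>D \<ge> \<R>p\<close> iff \<open>\<lfloor>\<R>\<^sup>-\<^sup>1D\<rfloor> \<ge> p\<close>, the affine map \<open>\<nu> \<mapsto> \<R>\<nu> + R - 1\<close>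
  carries the extreme points of \<open>\<Lambda>\<close> onto those of \<open>\<R>\<Lambda>\<close> and shifts degrees by a constant; hence both
  conditions pass from either lattice to the other.
\<close>

section \<open>Degrees\<close>

lemma degR_add: "degR R (x + y) = degR R x + degR R y"
  by (simp add: degR_def algebra_simps sum.distrib)

lemma degR_diff: "degR R (x - y) = degR R x - degR R y"
  by (simp add: degR_def algebra_simps sum_subtractf)

lemma degR_mono: "x \<le> y \<Longrightarrow> degR R x \<le> degR R y"
  unfolding degR_def by (intro sum_mono mult_right_mono) (auto simp: less_eq_vec_def)

lemma degR_strict_mono:
  assumes pos: "\<forall>i. R $ i > 0" and "x \<le> y" "x \<noteq> y"
  shows "degR R x < degR R y"
proof -
  obtain i where "x $ i \<noteq> y $ i"
    using \<open>x \<noteq> y\<close> by (auto simp: vec_eq_iff)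
  with \<open>x \<le> y\<close> have "x $ i < y $ i"
    by (metis less_eq_vec_def order_less_le)
  with pos \<open>x \<le> y\<close> show ?thesis
    unfolding degR_def
    by (intro sum_strict_mono_ex1) (auto simp: less_eq_vec_def intro!: mult_right_mono)
qed

section \<open>Attained extrema of bounded sets of integers\<close>

lemma ex_greatest_int:
  fixes S :: "int set"
  assumes "x \<in> S" and bound: "\<And>y. y \<in> S \<Longrightarrow> y \<le> b"
  obtains m where "m \<in> S" "\<And>y. y \<in> S \<Longrightarrow> y \<le> m"
proof -
  obtain m where "m \<in> S" "\<And>y. y \<in> S \<Longrightarrow> nat (b - m) \<le> nat (b - y)"
    using ex_has_least_nat[of "\<lambda>y. y \<in> S" x "\<lambda>y. nat (b - y)"] \<open>x \<in> S\<close> by blast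
  moreover have "y \<le> m" if "y \<in> S" for y
    using calculation(2)[OF that] bound[OF that] by linarith
  ultimately show thesis using that by blast
qed

lemma ex_least_int:
  fixes S :: "int set"
  assumes "x \<in> S" and bound: "\<And>y. y \<in> S \<Longrightarrow> b \<le> y"
  obtains m where "m \<in> S" "\<And>y. y \<in> S \<Longrightarrow> m \<le> y"
proof -
  obtain m where m: "m \<in> uminus ` S" "\<And>y. y \<in> uminus ` S \<Longrightarrow> y \<le> m"
  proof (rule ex_greatest_int)
    show "- x \<in> uminus ` S" using \<open>x \<in> S\<close> by simp
    show "y \<le> - b" if "y \<in> uminus ` S" for y
      using that bound by auto
  qed blast
  have "- m \<in> S" using m(1) by auto
  moreover have "- m \<le> y" if "y \<in> S" for y
    using m(2)[of "- y"] that by simp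
  ultimately show thesis using that by blast
qed

section \<open>Extreme points\<close>

lemma Sigma_region_down: "D \<in> Sigma_region \<Lambda> \<Longrightarrow> D' \<le> D \<Longrightarrow> D' \<in> Sigma_region \<Lambda>"
  by (auto simp: Sigma_region_def intro: order_trans)

text \<open>The region is closed downwards, so local maximality of the degree already forces
  maximality in the coordinatewise order. The new description no longer mentions \<open>R\<close>,
  which makes the extreme points for \<open>R\<close> and for \<open>1\<close> comparable.\<close>

lemma Ext_Sigma_eq_maximal:
  assumes pos: "\<forall>i. R $ i > 0"
  shows "Ext_Sigma R \<Lambda> =
    {\<nu> \<in> Sigma_region \<Lambda>. \<forall>q\<in>Sigma_region \<Lambda>. \<nu> \<le> q \<longrightarrow> q = \<nu>}"
proof (intro set_eqI iffI)
  fix \<nu>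
  assume \<nu>: "\<nu> \<in> Ext_Sigma R \<Lambda>"
  have "q = \<nu>" if q: "q \<in> Sigma_region \<Lambda>" and le: "\<nu> \<le> q" for q
  proof (rule ccontr)
    assume "q \<noteq> \<nu>"
    then obtain i where "q $ i \<noteq> \<nu> $ i" by (auto simp: vec_eq_iff)
    with le have i: "\<nu> $ i < q $ i" by (metis less_eq_vec_def order_less_le)
    \<comment> \<open>One unit step from \<nu> towards \<open>q\<close> stays below
      \<open>q\<close>, hence in the region, but raises the degree.\<close>
    let ?p = "\<nu> + axis i 1"
    have "?p \<le> q"
      using le i by (auto simp: less_eq_vec_def axis_def)
    then have "?p \<in> Sigma_region \<Lambda>"
      using q Sigma_region_down by blast
    moreover have "(\<Sum>j\<in>UNIV. \<bar>?p $ j - \<nu> $ j\<bar>) \<le> 1"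
      by (simp add: axis_def if_distrib[of abs] cong: if_cong)
    ultimately have "degR R ?p \<le> degR R \<nu>"
      using \<nu> by (auto simp: Ext_Sigma_def)
    moreover have "\<nu> \<noteq> ?p" "\<nu> \<le> ?p"
      by (auto simp: vec_eq_iff less_eq_vec_def axis_def)
    ultimately show False
      using degR_strict_mono[OF pos] by fastforce
  qed
  with \<nu> show "\<nu> \<in> {\<nu> \<in> Sigma_region \<Lambda>. \<forall>q\<in>Sigma_region \<Lambda>. \<nu> \<le> q \<longrightarrow> q = \<nu>}"
    by (auto simp: Ext_Sigma_def)
next
  fix \<nu>
  assume \<nu>: "\<nu> \<in> {\<nu> \<in> Sigma_region \<Lambda>. \<forall>q\<in>Sigma_region \<Lambda>. \<nu> \<le> q \<longrightarrow> q = \<nu>}"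
  have "degR R q \<le> degR R \<nu>"
    if q: "q \<in> Sigma_region \<Lambda>" and dist: "(\<Sum>j\<in>UNIV. \<bar>q $ j - \<nu> $ j\<bar>) \<le> 1" for q
  proof (cases "q \<le> \<nu>")
    case False
    then obtain i where i: "\<nu> $ i < q $ i"
      by (auto simp: less_eq_vec_def not_le)
    have "(\<Sum>j\<in>UNIV. \<bar>q $ j - \<nu> $ j\<bar>) = \<bar>q $ i - \<nu> $ i\<bar> + (\<Sum>j\<in>UNIV-{i}. \<bar>q $ j - \<nu> $ j\<bar>)"
      by (simp add: sum.remove)
    \<comment> \<open>Coordinate \<open>i\<close> alone uses up the whole distance 1, so
      \<open>q\<close> agrees with \<nu> elsewhere and lies above it.\<close>
    with dist i have "(\<Sum>j\<in>UNIV-{i}. \<bar>q $ j - \<nu> $ j\<bar>) \<le> 0"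
      by linarith
    then have "(\<Sum>j\<in>UNIV-{i}. \<bar>q $ j - \<nu> $ j\<bar>) = 0"
      by (intro antisym sum_nonneg) auto
    then have eq: "q $ j = \<nu> $ j" if "j \<noteq> i" for j
      using that by (simp add: sum_nonneg_eq_0_iff)
    have "\<nu> $ j \<le> q $ j" for j
      using i eq[of j] by (cases "j = i") auto
    then have "\<nu> \<le> q"
      by (simp add: less_eq_vec_def)
    with \<nu> q show ?thesis by auto
  qed (rule degR_mono)
  with \<nu> show "\<nu> \<in> Ext_Sigma R \<Lambda>"
    by (auto simp: Ext_Sigma_def)
qed

lemma negative_degR_in_Sigma_region:
  assumes "\<Lambda> \<subseteq> LambdaR R" and "degR R D < 0"
  shows "D \<in> Sigma_region \<Lambda>"
proof -
  have "\<not> p \<le> D" if "p \<in> \<Lambda>" for p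
    using assms that degR_mono[of p D R] by (auto simp: LambdaR_def)
  then show ?thesis by (simp add: Sigma_region_def)
qed

text \<open>By maximality \<nu> + 1 leaves the region, so its degree cannot be negative. This bound
  makes the minimum behind \<open>g_min\<close> exist.\<close>

lemma degR_Ext_Sigma_ge:
  assumes pos: "\<forall>i. R $ i > 0" and L: "\<Lambda> \<subseteq> LambdaR R" and \<nu>: "\<nu> \<in> Ext_Sigma R \<Lambda>"
  shows "- degR R 1 \<le> degR R \<nu>"
proof -
  have "\<nu> \<le> \<nu> + 1" "\<nu> + 1 \<noteq> \<nu>"
    by (auto simp: less_eq_vec_def vec_eq_iff)
  with \<nu> have "\<nu> + 1 \<notin> Sigma_region \<Lambda>"
    by (auto simp: Ext_Sigma_eq_maximal[OF pos])
  then have "0 \<le> degR R (\<nu> + 1)"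
    using negative_degR_in_Sigma_region[OF L] by force
  then show ?thesis by (simp add: degR_add)
qed

section \<open>Full sub-lattices\<close>

lemma is_lattice_add:
  assumes "is_lattice \<Lambda>" "x \<in> \<Lambda>" "y \<in> \<Lambda>"
  shows "x + y \<in> \<Lambda>"
proof -
  have "x - (0 - y) \<in> \<Lambda>"
    using assms unfolding is_lattice_def by blast
  then show ?thesis by simp
qed

lemma is_lattice_sum:
  assumes "is_lattice \<Lambda>" "\<And>b. b \<in> B \<Longrightarrow> f b \<in> \<Lambda>"
  shows "sum f B \<in> \<Lambda>"
  using assms(2)
proof (induction B rule: infinite_finite_induct)
  case (infinite B)
  then show ?case using assms(1) by (simp add: is_lattice_def)
next
  case empty
  show ?case using assms(1) by (simp add: is_lattice_def)
next
  case (insert b B)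
  then show ?case using is_lattice_add[OF assms(1)] by simp
qed

lemma is_lattice_scale:
  fixes k :: int
  assumes L: "is_lattice \<Lambda>" and x: "x \<in> \<Lambda>"
  shows "(\<chi> i. k * x $ i) \<in> \<Lambda>"
proof (induction k rule: int_induct[where k = 0])
  case base
  show ?case using L by (simp add: is_lattice_def flip: zero_vec_def)
next
  case (step1 k)
  have "(\<chi> i. (k + 1) * x $ i) = (\<chi> i. k * x $ i) + x"
    by (simp add: vec_eq_iff algebra_simps)
  with step1 show ?case using is_lattice_add[OF L _ x] by simp
next
  case (step2 k)
  have "(\<chi> i. (k - 1) * x $ i) = (\<chi> i. k * x $ i) - x"
    by (simp add: vec_eq_iff algebra_simps)
  with step2 show ?case using L x by (simp add: is_lattice_def)
qed

text \<open>Round the coordinates of the projection of \<open>D\<close> to the hyperplane, in a basis taken from \<open>\<Lambda>\<close>.\<close>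

lemma degR_Sigma_region_bounded:
  fixes R :: "nat ^ 'n"
  assumes pos: "\<forall>i. R $ i > 0" and L: "full_sublattice R \<Lambda>"
  obtains C where "\<And>D. D \<in> Sigma_region \<Lambda> \<Longrightarrow> degR R D \<le> C"
proof -
  define a :: "real ^ 'n" where "a = (\<chi> i. real (R $ i))"
  define H where "H = {x. a \<bullet> x = 0}"
  have lat: "is_lattice \<Lambda>" using L by (simp add: full_sublattice_def)
  have a0: "a \<noteq> 0"
    using pos by (simp add: a_def vec_eq_iff)
  have a_deg: "a \<bullet> real_vec x = degR R x" for x
    by (simp add: a_def real_vec_def inner_vec_def degR_def mult.commute)
  have sub: "real_vec ` \<Lambda> \<subseteq> H"
    using L by (auto simp: H_def a_deg full_sublattice_def LambdaR_def)
  obtain B where B: "B \<subseteq> real_vec ` \<Lambda>" "independent B" "real_vec ` \<Lambda> \<subseteq> span B"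
    and card: "card B = dim (real_vec ` \<Lambda>)"
    using basis_exists by metis
  have finB: "finite B" using B(2) by (rule independent_imp_finite)
  \<comment> \<open>This is where full rank enters: \<open>B\<close> has as many elements as the
    dimension of the hyperplane \<open>H\<close> containing it.\<close>
  have "H \<subseteq> span B"
  proof (rule card_ge_dim_independent)
    show "B \<subseteq> H" using B(1) sub by blast
    show "dim H \<le> card B"
      using L dim_hyperplane[OF a0] card by (simp add: H_def full_sublattice_def lattice_rank_def)
  qed (fact B)
  have "\<forall>b\<in>B. \<exists>p\<in>\<Lambda>. b = real_vec p" using B(1) by blast
  then obtain l where l: "\<And>b. b \<in> B \<Longrightarrow> l b \<in> \<Lambda>" "\<And>b. b \<in> B \<Longrightarrow> b = real_vec (l b)"
    by metis
  \<comment> \<open>\<open>M\<close> bounds the error in each coordinate when all coefficients are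
    rounded down; \<open>s\<close> is the degree of the all-ones vector.\<close>
  define M where "M = (\<Sum>b\<in>B. norm b)"
  define s where "s = (\<Sum>i\<in>UNIV. real (R $ i))"
  have s: "s > 0"
    using pos unfolding s_def by (intro sum_pos) auto
  have "degR R D \<le> \<lceil>M * s\<rceil>" if D: "D \<in> Sigma_region \<Lambda>" for D
  proof (rule ccontr)
    assume "\<not> degR R D \<le> \<lceil>M * s\<rceil>"
    then have big: "M * s < degR R D" by linarith
    \<comment> \<open>Subtracting \<open>t\<close> from every coordinate of \<open>D\<close> brings
      its degree to 0. The assumption \<open>big\<close> says \<open>t > M\<close>, so this shift
      absorbs the rounding error and \<open>p \<le> D\<close> follows.\<close>
    define t where "t = degR R D / s"
    define x where "x = real_vec D - (\<chi> i. t)"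
    have "a \<bullet> (\<chi> i. t) = t * s"
      by (simp add: a_def inner_vec_def s_def sum_distrib_left mult.commute)
    then have "x \<in> H"
      using s by (simp add: H_def x_def inner_diff_right a_deg t_def)
    then obtain u where u: "x = (\<Sum>b\<in>B. u b *\<^sub>R b)"
      using \<open>H \<subseteq> span B\<close> span_finite[OF finB] by auto
    define p where "p = (\<Sum>b\<in>B. \<chi> i. \<lfloor>u b\<rfloor> * l b $ i)"
    have "p \<in> \<Lambda>"
      unfolding p_def by (intro is_lattice_sum[OF lat] is_lattice_scale[OF lat] l)
    moreover have "p $ i \<le> D $ i" for i
    proof -
      have "real_of_int (p $ i) = (\<Sum>b\<in>B. \<lfloor>u b\<rfloor> * b $ i)"
        using l(2) by (auto simp: p_def real_vec_def vec_eq_iff intro!: sum.cong)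
      also have "\<dots> \<le> (\<Sum>b\<in>B. u b * b $ i + norm b)"
      proof (rule sum_mono)
        fix b
        have "(\<lfloor>u b\<rfloor> - u b) * b $ i \<le> \<bar>\<lfloor>u b\<rfloor> - u b\<bar> * \<bar>b $ i\<bar>"
          by (metis abs_ge_self abs_mult)
        also have "\<dots> \<le> 1 * norm b"
          by (intro mult_mono component_le_norm_cart) linarith+
        finally show "\<lfloor>u b\<rfloor> * b $ i \<le> u b * b $ i + norm b"
          by (simp add: algebra_simps)
      qed
      also have "\<dots> = x $ i + M"
        by (simp add: u M_def sum.distrib)
      also have "\<dots> = D $ i - t + M"
        by (simp add: x_def real_vec_def)
      also have "\<dots> \<le> D $ i"
        using big s by (simp add: t_def field_simps)
      finally show ?thesis by simp
    qed
    ultimately show False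
      using D by (auto simp: Sigma_region_def less_eq_vec_def)
  qed
  with that show thesis by blast
qed

text \<open>Degrees on the region are bounded above, so some point of the region above
  \<open>D\<close> has largest degree; strict monotonicity of the degree makes it maximal.\<close>

lemma Sigma_region_le_Ext_Sigma:
  assumes pos: "\<forall>i. R $ i > 0" and L: "full_sublattice R \<Lambda>" and D: "D \<in> Sigma_region \<Lambda>"
  obtains \<nu> where "\<nu> \<in> Ext_Sigma R \<Lambda>" "D \<le> \<nu>"
proof -
  obtain C where C: "\<And>D. D \<in> Sigma_region \<Lambda> \<Longrightarrow> degR R D \<le> C"
    using degR_Sigma_region_bounded[OF pos L] by blast
  let ?S = "{q \<in> Sigma_region \<Lambda>. D \<le> q}"
  obtain m where m: "m \<in> degR R ` ?S" "\<And>y. y \<in> degR R ` ?S \<Longrightarrow> y \<le> m"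
    using ex_greatest_int[of "degR R D" "degR R ` ?S" C] C D by auto
  then obtain \<nu> where \<nu>: "\<nu> \<in> Sigma_region \<Lambda>" "D \<le> \<nu>" "m = degR R \<nu>" by auto
  have "q = \<nu>" if "q \<in> Sigma_region \<Lambda>" "\<nu> \<le> q" for q
    using m(2)[of "degR R q"] that \<nu> degR_strict_mono[OF pos, of \<nu> q] by fastforce
  with \<nu> that show thesis by (auto simp: Ext_Sigma_eq_maximal[OF pos])
qed

lemma Ext_Sigma_nonempty:
  assumes pos: "\<forall>i. R $ i > 0" and L: "full_sublattice R \<Lambda>"
  shows "Ext_Sigma R \<Lambda> \<noteq> {}"
proof -
  have "degR R (-1) < degR R 0"
    using pos by (intro degR_strict_mono) (auto simp: less_eq_vec_def vec_eq_iff)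
  then have "-1 \<in> Sigma_region \<Lambda>"
    using L by (intro negative_degR_in_Sigma_region) (auto simp: full_sublattice_def degR_def)
  then show ?thesis
    using Sigma_region_le_Ext_Sigma[OF pos L] by blast
qed

section \<open>The genus bounds as genuine extrema, and uniformity\<close>

lemma g_min_attained:
  assumes pos: "\<forall>i. R $ i > 0" and L: "full_sublattice R \<Lambda>"
  shows "g_min R \<Lambda> - 1 \<in> degR R ` Ext_Sigma R \<Lambda>"
    and "\<nu> \<in> Ext_Sigma R \<Lambda> \<Longrightarrow> g_min R \<Lambda> - 1 \<le> degR R \<nu>"
proof -
  obtain \<mu> where \<mu>: "\<mu> \<in> Ext_Sigma R \<Lambda>" using Ext_Sigma_nonempty[OF pos L] by blast
  obtain m where m: "m \<in> degR R ` Ext_Sigma R \<Lambda>" "\<And>y. y \<in> degR R ` Ext_Sigma R \<Lambda> \<Longrightarrow> m \<le> y"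
    using ex_least_int[of "degR R \<mu>" "degR R ` Ext_Sigma R \<Lambda>" "- degR R 1"] \<mu> L
      degR_Ext_Sigma_ge[OF pos] unfolding full_sublattice_def by auto
  then have "g_min R \<Lambda> - 1 = m"
    unfolding g_min_def by (simp add: Least_equality)
  with m show "g_min R \<Lambda> - 1 \<in> degR R ` Ext_Sigma R \<Lambda>"
    and "\<nu> \<in> Ext_Sigma R \<Lambda> \<Longrightarrow> g_min R \<Lambda> - 1 \<le> degR R \<nu>" by auto
qed

lemma g_max_attained:
  assumes pos: "\<forall>i. R $ i > 0" and L: "full_sublattice R \<Lambda>"
  shows "g_max R \<Lambda> - 1 \<in> degR R ` Ext_Sigma R \<Lambda>"
    and "\<nu> \<in> Ext_Sigma R \<Lambda> \<Longrightarrow> degR R \<nu> \<le> g_max R \<Lambda> - 1"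
proof -
  obtain \<mu> where \<mu>: "\<mu> \<in> Ext_Sigma R \<Lambda>" using Ext_Sigma_nonempty[OF pos L] by blast
  obtain C where C: "\<And>D. D \<in> Sigma_region \<Lambda> \<Longrightarrow> degR R D \<le> C"
    using degR_Sigma_region_bounded[OF pos L] by blast
  obtain m where m: "m \<in> degR R ` Ext_Sigma R \<Lambda>" "\<And>y. y \<in> degR R ` Ext_Sigma R \<Lambda> \<Longrightarrow> y \<le> m"
  proof (rule ex_greatest_int[of "degR R \<mu>" "degR R ` Ext_Sigma R \<Lambda>" C])
    show "y \<le> C" if "y \<in> degR R ` Ext_Sigma R \<Lambda>" for y
      using that C by (auto simp: Ext_Sigma_def)
  qed (use \<mu> in auto)
  then have "g_max R \<Lambda> - 1 = m"
    unfolding g_max_def by (simp add: Greatest_equality)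
  with m show "g_max R \<Lambda> - 1 \<in> degR R ` Ext_Sigma R \<Lambda>"
    and "\<nu> \<in> Ext_Sigma R \<Lambda> \<Longrightarrow> degR R \<nu> \<le> g_max R \<Lambda> - 1" by auto
qed

lemma uniform_lattice_iff:
  assumes pos: "\<forall>i. R $ i > 0" and L: "full_sublattice R \<Lambda>"
  shows "uniform_lattice R \<Lambda> \<longleftrightarrow> (\<exists>d. \<forall>\<nu>\<in>Ext_Sigma R \<Lambda>. degR R \<nu> = d)"
proof
  assume "uniform_lattice R \<Lambda>"
  then have "degR R \<nu> = g_min R \<Lambda> - 1" if "\<nu> \<in> Ext_Sigma R \<Lambda>" for \<nu>
    using g_min_attained(2)[OF pos L that] g_max_attained(2)[OF pos L that]
    by (simp add: uniform_lattice_def)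
  then show "\<exists>d. \<forall>\<nu>\<in>Ext_Sigma R \<Lambda>. degR R \<nu> = d" by blast
next
  assume "\<exists>d. \<forall>\<nu>\<in>Ext_Sigma R \<Lambda>. degR R \<nu> = d"
  then have "g_min R \<Lambda> - 1 = g_max R \<Lambda> - 1"
    using g_min_attained(1)[OF pos L] g_max_attained(1)[OF pos L] by force
  then show "uniform_lattice R \<Lambda>" by (simp add: uniform_lattice_def)
qed

section \<open>Riemann-Roch and reflections\<close>

text \<open>Effective divisors \<open>E\<close> equivalent to \<open>D\<close> correspond to lattice
  points below \<open>D\<close> through \<open>E = D - p\<close>.\<close>

lemma linear_system_empty_iff: "linear_system \<Lambda> D = {} \<longleftrightarrow> D \<in> Sigma_region \<Lambda>" if "is_lattice \<Lambda>"
proof -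
  have neg: "- p \<in> \<Lambda>" if "p \<in> \<Lambda>" for p
    using that \<open>is_lattice \<Lambda>\<close> unfolding is_lattice_def by (metis diff_0)
  have "E \<in> linear_system \<Lambda> D \<longleftrightarrow> 0 \<le> E \<and> D - E \<in> \<Lambda>" for E
    using neg[of "E - D"] neg[of "D - E"] by (auto simp: linear_system_def lin_equiv_def)
  moreover have "(\<exists>E. 0 \<le> E \<and> D - E \<in> \<Lambda>) \<longleftrightarrow> (\<exists>p\<in>\<Lambda>. p \<le> D)"
  proof
    assume "\<exists>p\<in>\<Lambda>. p \<le> D"
    then obtain p where "p \<in> \<Lambda>" "p \<le> D" by blast
    then show "\<exists>E. 0 \<le> E \<and> D - E \<in> \<Lambda>"
      by (intro exI[of _ "D - p"]) (auto simp: less_eq_vec_def)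
  next
    assume "\<exists>E. 0 \<le> E \<and> D - E \<in> \<Lambda>"
    then obtain E where "0 \<le> E" "D - E \<in> \<Lambda>" by blast
    then show "\<exists>p\<in>\<Lambda>. p \<le> D"
      by (intro bexI[of _ "D - E"]) (auto simp: less_eq_vec_def)
  qed
  ultimately show ?thesis
    by (auto simp: Sigma_region_def)
qed

section \<open>The rank expressed through the region\<close>

lemma divisor_rank_attained:
  assumes pos: "\<forall>i. R $ i > 0" and L: "full_sublattice R \<Lambda>"
  shows "\<exists>E\<ge>0. D - E \<in> Sigma_region \<Lambda> \<and> degR R E = divisor_rank R \<Lambda> D + 1"
    and "E \<ge> 0 \<Longrightarrow> D - E \<in> Sigma_region \<Lambda> \<Longrightarrow> divisor_rank R \<Lambda> D + 1 \<le> degR R E"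
proof -
  let ?S = "{degR R E | E. E \<ge> 0 \<and> linear_system \<Lambda> (D - E) = {}}"
  have lat: "is_lattice \<Lambda>" using L by (simp add: full_sublattice_def)
  obtain \<nu> where \<nu>: "\<nu> \<in> Sigma_region \<Lambda>"
    using Ext_Sigma_nonempty[OF pos L] by (auto simp: Ext_Sigma_def)
  \<comment> \<open>The positive part of \<open>D - \<nu>\<close> is the least effective divisor
    that pushes \<open>D\<close> below \<nu>.\<close>
  define E where "E = (\<chi> i. max 0 (D $ i - \<nu> $ i))"
  have "E \<ge> 0" "D - E \<le> \<nu>"
    by (auto simp: E_def less_eq_vec_def)
  then have "degR R E \<in> ?S"
    using \<nu> Sigma_region_down linear_system_empty_iff[OF lat] by blast
  moreover have "0 \<le> y" if "y \<in> ?S" for y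
    using that degR_mono[of 0 _ R] by (auto simp: degR_def)
  ultimately obtain m where m: "m \<in> ?S" "\<And>y. y \<in> ?S \<Longrightarrow> m \<le> y"
    using ex_least_int[of "degR R E" ?S 0] by blast
  then have "divisor_rank R \<Lambda> D + 1 = m"
    unfolding divisor_rank_def by (simp add: Least_equality)
  with m show "\<exists>E\<ge>0. D - E \<in> Sigma_region \<Lambda> \<and> degR R E = divisor_rank R \<Lambda> D + 1"
    and "E \<ge> 0 \<Longrightarrow> D - E \<in> Sigma_region \<Lambda> \<Longrightarrow> divisor_rank R \<Lambda> D + 1 \<le> degR R E" for E
    using linear_system_empty_iff[OF lat] by auto
qed

text \<open>Rank -1 means that the minimal degree is 0, and for positive weights the only effective
  divisor of degree 0 is 0 itself.\<close>

lemma divisor_rank_eq_minus_one_iff: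
  assumes pos: "\<forall>i. R $ i > 0" and L: "full_sublattice R \<Lambda>"
  shows "divisor_rank R \<Lambda> D = -1 \<longleftrightarrow> D \<in> Sigma_region \<Lambda>"
proof
  assume "divisor_rank R \<Lambda> D = -1"
  then obtain E where E: "E \<ge> 0" "D - E \<in> Sigma_region \<Lambda>" "degR R E = 0"
    using divisor_rank_attained(1)[OF pos L, of D] by auto
  then have "E = 0"
    using degR_strict_mono[OF pos, of 0 E] by (auto simp: degR_def)
  with E show "D \<in> Sigma_region \<Lambda>" by simp
next
  assume D: "D \<in> Sigma_region \<Lambda>"
  obtain E where "E \<ge> 0" "degR R E = divisor_rank R \<Lambda> D + 1"
    using divisor_rank_attained(1)[OF pos L] by blast
  with degR_mono[of 0 E R] divisor_rank_attained(2)[OF pos L, of 0 D] D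
  show "divisor_rank R \<Lambda> D = -1" by (auto simp: degR_def)
qed

text \<open>One half of Riemann-Roch: an optimal \<open>E\<close> for \<open>D\<close> is turned
  into a competitor for \<open>K - D\<close> of degree
  \<open>d - degR R D + degR R E\<close>.\<close>

lemma divisor_rank_reflect_le:
  assumes pos: "\<forall>i. R $ i > 0" and L: "full_sublattice R \<Lambda>"
    and deg: "\<And>\<nu>. \<nu> \<in> Ext_Sigma R \<Lambda> \<Longrightarrow> degR R \<nu> = d"
    and refl: "\<And>\<nu>. \<nu> \<in> Ext_Sigma R \<Lambda> \<Longrightarrow> K - \<nu> \<in> Ext_Sigma R \<Lambda>"
  shows "divisor_rank R \<Lambda> (K - D) \<le> divisor_rank R \<Lambda> D + d - degR R D"
proof -
  obtain E where E: "E \<ge> 0" "D - E \<in> Sigma_region \<Lambda>" "degR R E = divisor_rank R \<Lambda> D + 1"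
    using divisor_rank_attained(1)[OF pos L] by blast
  obtain \<nu> where \<nu>: "\<nu> \<in> Ext_Sigma R \<Lambda>" "D - E \<le> \<nu>"
    using Sigma_region_le_Ext_Sigma[OF pos L E(2)] by blast
  \<comment> \<open>Swapping \<open>E\<close> with the gap between \<open>D - E\<close> and \<nu>
    works because \<open>K - D - ?F\<close> equals \<open>K - \<nu> - E\<close>.\<close>
  let ?F = "\<nu> - (D - E)"
  have "K - D - ?F \<le> K - \<nu>"
    using E(1) by (simp add: less_eq_vec_def)
  then have "K - D - ?F \<in> Sigma_region \<Lambda>"
    using refl[OF \<nu>(1)] Sigma_region_down by (auto simp: Ext_Sigma_def)
  moreover have "0 \<le> ?F"
    using \<nu>(2) by (simp add: less_eq_vec_def)
  ultimately have "divisor_rank R \<Lambda> (K - D) + 1 \<le> degR R ?F"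
    using divisor_rank_attained(2)[OF pos L] by blast
  with E(3) deg[OF \<nu>(1)] show ?thesis
    by (simp add: degR_diff)
qed

lemma riemann_roch_property_iff_reflection:
  assumes pos: "\<forall>i. R $ i > 0" and L: "full_sublattice R \<Lambda>"
  shows "riemann_roch_property R \<Lambda> \<longleftrightarrow> uniform_lattice R \<Lambda> \<and>
    (\<exists>K. \<forall>\<nu>\<in>Ext_Sigma R \<Lambda>. K - \<nu> \<in> Ext_Sigma R \<Lambda>)"
proof (cases "uniform_lattice R \<Lambda>")
  case True
  define g where "g = g_min R \<Lambda>"
  have deg: "degR R \<nu> = g - 1" if "\<nu> \<in> Ext_Sigma R \<Lambda>" for \<nu>
    using g_min_attained(2)[OF pos L that] g_max_attained(2)[OF pos L that] True
    by (simp add: g_def uniform_lattice_def)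
  have "(\<exists>K. degR R K = 2 * g - 2 \<and>
          (\<forall>D. divisor_rank R \<Lambda> D - divisor_rank R \<Lambda> (K - D) = degR R D - g + 1)) \<longleftrightarrow>
        (\<exists>K. \<forall>\<nu>\<in>Ext_Sigma R \<Lambda>. K - \<nu> \<in> Ext_Sigma R \<Lambda>)" (is "?RR \<longleftrightarrow> ?refl")
  proof
    assume ?RR
    then obtain K where K: "degR R K = 2 * g - 2"
      "\<And>D. divisor_rank R \<Lambda> D - divisor_rank R \<Lambda> (K - D) = degR R D - g + 1"
      by blast
    have "K - \<nu> \<in> Ext_Sigma R \<Lambda>" if \<nu>: "\<nu> \<in> Ext_Sigma R \<Lambda>" for \<nu>
    proof -
      \<comment> \<open>At \<open>D = \<nu>\<close> the right side of the formula vanishes and \<nu>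
        has rank -1, so \<open>K - \<nu>\<close> has rank -1 too.\<close>
      have "\<nu> \<in> Sigma_region \<Lambda>" using \<nu> by (simp add: Ext_Sigma_def)
      then have "divisor_rank R \<Lambda> (K - \<nu>) = -1"
        using K(2)[of \<nu>] deg[OF \<nu>] divisor_rank_eq_minus_one_iff[OF pos L, of \<nu>] by simp
      then have "K - \<nu> \<in> Sigma_region \<Lambda>"
        using divisor_rank_eq_minus_one_iff[OF pos L] by blast
      then obtain \<mu> where \<mu>: "\<mu> \<in> Ext_Sigma R \<Lambda>" "K - \<nu> \<le> \<mu>"
        using Sigma_region_le_Ext_Sigma[OF pos L] by blast
      \<comment> \<open>Comparable points of equal degree coincide, so \<open>K - \<nu>\<close> is
        the extreme point \<mu>.\<close>
      have "degR R (K - \<nu>) = degR R \<mu>"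
        using K(1) deg[OF \<nu>] deg[OF \<mu>(1)] by (simp add: degR_diff)
      with \<mu> degR_strict_mono[OF pos, of "K - \<nu>" \<mu>] show ?thesis
        by fastforce
    qed
    then show ?refl by blast
  next
    assume ?refl
    then obtain K where K: "\<And>\<nu>. \<nu> \<in> Ext_Sigma R \<Lambda> \<Longrightarrow> K - \<nu> \<in> Ext_Sigma R \<Lambda>"
      by blast
    obtain \<nu> where \<nu>: "\<nu> \<in> Ext_Sigma R \<Lambda>"
      using Ext_Sigma_nonempty[OF pos L] by blast
    have degK: "degR R K = 2 * g - 2"
      using deg[OF \<nu>] deg[OF K[OF \<nu>]] by (simp add: degR_diff)
    \<comment> \<open>Since \<open>K\<close> has degree \<open>2 * g - 2\<close>, the inequalities
      for \<open>D\<close> and for \<open>K - D\<close> are opposite to each other.\<close>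
    have "divisor_rank R \<Lambda> D - divisor_rank R \<Lambda> (K - D) = degR R D - g + 1" for D
      using divisor_rank_reflect_le[OF pos L deg K, of D]
        divisor_rank_reflect_le[OF pos L deg K, of "K - D"] degK
      by (simp add: degR_diff)
    with degK show ?RR by blast
  qed
  with True show ?thesis
    by (simp add: riemann_roch_property_def Let_def g_def)
qed (simp add: riemann_roch_property_def)

section \<open>Scaling\<close>

text \<open>For positive \<open>R\<close> this is the largest vector whose coordinatewise quotient
  by \<open>R\<close>, rounded down, is \<open>x\<close>: the top corner of the box of integer
  points over \<open>x\<close>.\<close>

definition ext_lift :: "nat ^ 'n \<Rightarrow> int ^ 'n \<Rightarrow> int ^ 'n" where
  "ext_lift R x = (\<chi> i. int (R $ i) * x $ i + int (R $ i) - 1)"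

definition vec_div :: "int ^ 'n \<Rightarrow> nat ^ 'n \<Rightarrow> int ^ 'n" where
  "vec_div x R = (\<chi> i. x $ i div int (R $ i))"

text \<open>Division rounding down is right adjoint to multiplication by a positive integer, so
  lying above a scaled lattice point can be tested after division.\<close>

lemma Sigma_region_scaled_iff:
  assumes pos: "\<forall>i. R $ i > 0"
  shows "D \<in> Sigma_region (scaled_lattice R \<Lambda>) \<longleftrightarrow> vec_div D R \<in> Sigma_region \<Lambda>"
proof -
  have "r * x \<le> y \<longleftrightarrow> x \<le> y div r" if "r > 0" for r x y :: int
  proof
    assume "r * x \<le> y"
    with that show "x \<le> y div r" using zdiv_mono1[of "r * x" y r] by simp
  next
    assume "x \<le> y div r"
    then have "r * x \<le> r * (y div r)" using that by (simp add: mult_left_mono)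
    also have "\<dots> \<le> y" using that mult_div_mod_eq[of r y] pos_mod_sign[of r y] by linarith
    finally show "r * x \<le> y" .
  qed
  then have "int (R $ i) * p $ i \<le> D $ i \<longleftrightarrow> p $ i \<le> D $ i div int (R $ i)" for p i
    using pos by simp
  then show ?thesis
    by (simp add: Sigma_region_def scaled_lattice_def less_eq_vec_def vec_div_def
        diag_matrix_mult_nth)
qed

lemma vec_div_mono:
  assumes "x \<le> y"
  shows "vec_div x R \<le> vec_div y R"
proof -
  \<comment> \<open>Division by 0 gives 0, so a vanishing weight is harmless.\<close>
  have "x $ i div int (R $ i) \<le> y $ i div int (R $ i)" for i
    using assms by (cases "R $ i = 0") (auto simp: less_eq_vec_def intro: zdiv_mono1)
  then show ?thesis by (simp add: vec_div_def less_eq_vec_def)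
qed

lemma ext_lift_mono: "x \<le> y \<Longrightarrow> ext_lift R x \<le> ext_lift R y"
  by (simp add: ext_lift_def less_eq_vec_def mult_left_mono zle_diff1_eq [symmetric] del: zle_diff1_eq)

lemma vec_div_ext_lift:
  assumes pos: "\<forall>i. R $ i > 0"
  shows "vec_div (ext_lift R x) R = x"
proof -
  have "(r * y + r - 1) div r = y" if "r > 0" for r y :: int
    using that div_mult_self2[of r "r - 1" y] by (simp add: algebra_simps)
  with pos show ?thesis
    by (simp add: vec_div_def ext_lift_def vec_eq_iff)
qed

lemma le_ext_lift_vec_div:
  assumes pos: "\<forall>i. R $ i > 0"
  shows "x \<le> ext_lift R (vec_div x R)"
proof -
  have "y \<le> r * (y div r) + r - 1" if "r > 0" for r y :: int
    using that pos_mod_bound[of r y] mult_div_mod_eq[of r y] by linarith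
  with pos show ?thesis
    by (simp add: vec_div_def ext_lift_def less_eq_vec_def)
qed

text \<open>Membership in the scaled region depends only on the box containing the point, so maximal
  points sit at top corners, and these are ordered as the boxes are.\<close>

lemma Ext_Sigma_scaled:
  assumes pos: "\<forall>i. R $ i > 0"
  shows "Ext_Sigma 1 (scaled_lattice R \<Lambda>) = ext_lift R ` Ext_Sigma R \<Lambda>"
proof -
  have pos1: "\<forall>i. (1 :: nat ^ 'n) $ i > 0" by simp
  note simps = Ext_Sigma_eq_maximal[OF pos] Ext_Sigma_eq_maximal[OF pos1]
    Sigma_region_scaled_iff[OF pos]
  show ?thesis
  proof (intro set_eqI iffI)
    fix D
    assume D: "D \<in> Ext_Sigma 1 (scaled_lattice R \<Lambda>)"
    \<comment> \<open>The top corner of the box of \<open>D\<close> also lies in the region and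
      above \<open>D\<close>, so maximality gives equality.\<close>
    then have D_eq: "ext_lift R (vec_div D R) = D"
      using le_ext_lift_vec_div[OF pos, of D] by (auto simp: simps vec_div_ext_lift[OF pos])
    have "q = vec_div D R" if "q \<in> Sigma_region \<Lambda>" "vec_div D R \<le> q" for q
    proof -
      have "D \<le> ext_lift R q" using ext_lift_mono[OF that(2), of R] D_eq by simp
      with D that(1) have "ext_lift R q = D" by (auto simp: simps vec_div_ext_lift[OF pos])
      then show ?thesis using vec_div_ext_lift[OF pos] by metis
    qed
    with D have "vec_div D R \<in> Ext_Sigma R \<Lambda>" by (auto simp: simps)
    with D_eq show "D \<in> ext_lift R ` Ext_Sigma R \<Lambda>" by (metis imageI)
  next
    fix D
    assume "D \<in> ext_lift R ` Ext_Sigma R \<Lambda>"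
    then obtain \<nu> where \<nu>: "\<nu> \<in> Ext_Sigma R \<Lambda>" "D = ext_lift R \<nu>" by blast
    have "q = D" if "vec_div q R \<in> Sigma_region \<Lambda>" "D \<le> q" for q
    proof -
      have "\<nu> \<le> vec_div q R"
        using vec_div_mono[OF that(2), of R] \<nu>(2) vec_div_ext_lift[OF pos] by simp
      with \<nu> that(1) have "vec_div q R = \<nu>" by (auto simp: simps)
      \<comment> \<open>\<open>q\<close> is trapped between \<open>D\<close> and the top corner of
        its own box, which is \<open>D\<close>.\<close>
      with le_ext_lift_vec_div[OF pos, of q] \<nu>(2) that(2) show ?thesis by simp
    qed
    with \<nu> show "D \<in> Ext_Sigma 1 (scaled_lattice R \<Lambda>)"
      by (auto simp: simps vec_div_ext_lift[OF pos])
  qed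
qed

lemma degR_ext_lift: "degR 1 (ext_lift R \<nu>) = degR R \<nu> + (\<Sum>i\<in>UNIV. int (R $ i) - 1)"
  by (simp add: degR_def ext_lift_def sum.distrib sum_subtractf mult.commute)

text \<open>An injective affine map carries reflections to reflections. The delicate direction is
  downwards, where \<open>K'\<close> is not known in advance to be divisible suitably by
  \<open>R\<close>.\<close>

lemma reflection_scaled_iff:
  assumes pos: "\<forall>i. R $ i > 0" and nonempty: "Ext_Sigma R \<Lambda> \<noteq> {}"
  shows "(\<exists>K. \<forall>\<nu>\<in>Ext_Sigma 1 (scaled_lattice R \<Lambda>). K - \<nu> \<in> Ext_Sigma 1 (scaled_lattice R \<Lambda>))
    \<longleftrightarrow> (\<exists>K. \<forall>\<nu>\<in>Ext_Sigma R \<Lambda>. K - \<nu> \<in> Ext_Sigma R \<Lambda>)" (is "?scaled \<longleftrightarrow> ?orig")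
proof
  assume ?scaled
  then obtain K' where K': "\<And>\<nu>. \<nu> \<in> Ext_Sigma R \<Lambda> \<Longrightarrow> K' - ext_lift R \<nu> \<in> ext_lift R ` Ext_Sigma R \<Lambda>"
    unfolding Ext_Sigma_scaled[OF pos] by blast
  obtain \<mu> \<mu>' where "\<mu> \<in> Ext_Sigma R \<Lambda>" and \<mu>': "K' - ext_lift R \<mu> = ext_lift R \<mu>'"
    using nonempty K' by blast
  \<comment> \<open>The centre comes from one reflected pair: a reflection exchanging \<mu> and
    \<mu>' must have \<open>K = \<mu> + \<mu>'\<close>.\<close>
  have "\<mu> + \<mu>' - \<nu> \<in> Ext_Sigma R \<Lambda>" if \<nu>: "\<nu> \<in> Ext_Sigma R \<Lambda>" for \<nu>
  proof -
    obtain \<nu>' where \<nu>': "\<nu>' \<in> Ext_Sigma R \<Lambda>" "K' - ext_lift R \<nu> = ext_lift R \<nu>'"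
      using K'[OF \<nu>] by blast
    \<comment> \<open>Comparing the reflections of \<mu> and \<nu> eliminates \<open>K'\<close> and
      the offsets \<open>R - 1\<close>, leaving a common factor that can be cancelled.\<close>
    have "int (R $ i) * (\<mu> $ i + \<mu>' $ i - \<nu> $ i) = int (R $ i) * \<nu>' $ i" for i
    proof -
      have "K' $ i - ext_lift R \<mu> $ i = ext_lift R \<mu>' $ i"
        "K' $ i - ext_lift R \<nu> $ i = ext_lift R \<nu>' $ i"
        using \<mu>' \<nu>'(2) by (simp_all flip: vector_minus_component)
      then show ?thesis by (simp add: ext_lift_def algebra_simps)
    qed
    then have "\<mu> $ i + \<mu>' $ i - \<nu> $ i = \<nu>' $ i" for i
      using pos by (metis mult_cancel_left of_nat_0_eq_iff less_irrefl)
    then have "\<mu> + \<mu>' - \<nu> = \<nu>'"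
      by (simp add: vec_eq_iff)
    with \<nu>' show ?thesis by simp
  qed
  then show ?orig by blast
next
  assume ?orig
  then obtain K where K: "\<And>\<nu>. \<nu> \<in> Ext_Sigma R \<Lambda> \<Longrightarrow> K - \<nu> \<in> Ext_Sigma R \<Lambda>" by blast
  \<comment> \<open>The offset is doubled because \<open>K'\<close> is the sum of two lifted points,
    each contributing \<open>R - 1\<close>.\<close>
  define K' where "K' = (\<chi> i. int (R $ i) * K $ i + 2 * (int (R $ i) - 1))"
  have "K' - ext_lift R \<nu> = ext_lift R (K - \<nu>)" for \<nu>
    by (simp add: K'_def ext_lift_def vec_eq_iff algebra_simps)
  with K show ?scaled
    unfolding Ext_Sigma_scaled[OF pos] by blast
qed

theorem theorem2p32:
  fixes R :: "nat ^ 'n" and \<Lambda> :: "(int ^ 'n) set"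
  assumes "\<forall>i. R $ i > 0"
    and "full_sublattice R \<Lambda>"
    and "uniform_lattice R \<Lambda>"
  shows "riemann_roch_property R \<Lambda> \<longleftrightarrow> riemann_roch_property 1 (scaled_lattice R \<Lambda>)"
proof -
  note pos = assms(1) and L = assms(2)
  have pos1: "\<forall>i. (1 :: nat ^ 'n) $ i > 0" by simp
  have L1: "full_sublattice 1 (scaled_lattice R \<Lambda>)"
    by (rule full_sublattice_scaled_lattice[OF pos L])
  \<comment> \<open>The lift shifts all degrees by the same constant, so a common degree stays
    common.\<close>
  have "uniform_lattice 1 (scaled_lattice R \<Lambda>)"
    using assms(3) unfolding uniform_lattice_iff[OF pos L] uniform_lattice_iff[OF pos1 L1]
      Ext_Sigma_scaled[OF pos] by (auto simp: degR_ext_lift)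
  then show ?thesis
    unfolding riemann_roch_property_iff_reflection[OF pos L]
      riemann_roch_property_iff_reflection[OF pos1 L1]
      reflection_scaled_iff[OF pos Ext_Sigma_nonempty[OF pos L]]
    using assms(3) by simp
qed

end
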